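(* Let $X$ be a mixed graph whose underlying graph is bipartite with a unique perfect matching $\mathcal{M}$, let $\alpha$ be a complex number with $|\alpha|=1$, and let $H_\alpha$ be the $\alpha$-hermitian adjacency matrix of $X$. For vertices $i,j$ let $\Im_{i\to j}$ be the set of co-augmenting mixed paths from $i$ to $j$. Then \[(H_\alpha^{-1})_{ij}=\begin{cases}\displaystyle\sum_{P_{i\to j}\in\Im_{i\to j}}(-1)^{\frac{|E(P_{i\to j})|-1}{2}}\,h_\alpha(P_{i\to j}) & \text{if } i\neq j,\\ 0 & \text{if } i=j.\end{cases}\]
   Context: A mixed graph $X$ consists of a finite vertex set $V(X)$, a set $E_0(X)$ of undirected edges (digons) and a set $E_1(X)$ of directed edges (arcs), with no loops and at most one digon or arc between any two distinct vertices; its underlying graph $\Gamma(X)$ forgets orientations, and perfect matchings of $X$ are those of $\Gamma(X)$. For $|\alpha|=1$, $H_\alpha(X)=[h_{uv}]$ has $h_{uv}=1$ if $uv\in E_0(X)$, $h_{uv}=\alpha$ if $uv\in E_1(X)$ (arc from $u$ to $v$), $h_{uv}=\overline{\alpha}$ if $vu\in E_1(X)$, and $h_{uv}=0$ otherwise. A mixed path $P$ from $i$ to $j$ is a path $i=r_1,r_2,\dots,r_k=j$ in $\Gamma(X)$; $|E(P)|=k-1$ and $h_\alpha(P)=h_{r_1r_2}h_{r_2r_3}\cdots h_{r_{k-1}r_k}$. Such a path is co-augmenting if its edges alternate between edges of $\mathcal{M}$ and edges not in $\mathcal{M}$, with the first and last edges in $\mathcal{M}$. An empty sum is $0$. *)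

theory Defs
  imports "HOL-Analysis.Analysis"
begin

text \<open>The vertex set of a mixed graph is the whole (finite) type of vertices.\<close>

record 'v mixed_graph =
  digons :: "'v set set"
  arcs :: "('v \<times> 'v) set"

definition wf_mixed_graph :: "'v mixed_graph \<Rightarrow> bool" where
  "wf_mixed_graph X \<longleftrightarrow>
     (\<forall>e \<in> digons X. card e = 2) \<and>
     (\<forall>(u, v) \<in> arcs X. u \<noteq> v \<and> (v, u) \<notin> arcs X \<and> {u, v} \<notin> digons X)"

definition underlying_edges :: "'v mixed_graph \<Rightarrow> 'v set set" where
  "underlying_edges X = digons X \<union> {{u, v} | u v. (u, v) \<in> arcs X}"

definition bipartite :: "'v set set \<Rightarrow> bool" where
  "bipartite E \<longleftrightarrow>
     (\<exists>A B. A \<union> B = UNIV \<and> A \<inter> B = {} \<and> (\<forall>e \<in> E. \<exists>a \<in> A. \<exists>b \<in> B. e = {a, b}))"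

definition perfect_matching :: "'v set set \<Rightarrow> 'v set set \<Rightarrow> bool" where
  "perfect_matching E M \<longleftrightarrow> M \<subseteq> E \<and> (\<forall>v. \<exists>!e. e \<in> M \<and> v \<in> e)"

definition hermitian_adjacency :: "complex \<Rightarrow> 'v::finite mixed_graph \<Rightarrow> complex^'v^'v" where
  "hermitian_adjacency \<alpha> X =
     (\<chi> u v. if {u, v} \<in> digons X then 1
            else if (u, v) \<in> arcs X then \<alpha>
            else if (v, u) \<in> arcs X then cnj \<alpha>
            else 0)"

text \<open>There is at most one edge between two vertices, so a path is determined by its list of
  vertices.\<close>

definition path_edges :: "'v list \<Rightarrow> 'v set list" where
  "path_edges p = map (\<lambda>k. {p ! k, p ! Suc k}) [0..<length p - 1]"

definition mixed_path :: "'v mixed_graph \<Rightarrow> 'v \<Rightarrow> 'v \<Rightarrow> 'v list \<Rightarrow> bool" where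
  "mixed_path X i j p \<longleftrightarrow>
     p \<noteq> [] \<and> hd p = i \<and> last p = j \<and> distinct p \<and>
     set (path_edges p) \<subseteq> underlying_edges X"

definition path_weight :: "complex \<Rightarrow> 'v::finite mixed_graph \<Rightarrow> 'v list \<Rightarrow> complex" where
  "path_weight \<alpha> X p =
     (\<Prod>k < length p - 1. hermitian_adjacency \<alpha> X $ (p ! k) $ (p ! Suc k))"

definition co_augmenting :: "'v set set \<Rightarrow> 'v list \<Rightarrow> bool" where
  "co_augmenting M p \<longleftrightarrow>
     path_edges p \<noteq> [] \<and> hd (path_edges p) \<in> M \<and> last (path_edges p) \<in> M \<and>
     (\<forall>k. Suc k < length (path_edges p) \<longrightarrow>
        (path_edges p ! k \<in> M \<longleftrightarrow> path_edges p ! Suc k \<notin> M))"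

definition co_augmenting_paths :: "'v mixed_graph \<Rightarrow> 'v set set \<Rightarrow> 'v \<Rightarrow> 'v \<Rightarrow> 'v list set" where
  "co_augmenting_paths X M i j = {p. mixed_path X i j p \<and> co_augmenting M p}"

end

theory Submission
  imports Defs "HOL-Combinatorics.Cycles"
begin

text \<open>Write \<open>m\<close> for the map that sends a vertex to its partner in the matching, and let
  \<open>i \<rightarrow> k\<close> mean that \<open>k \<noteq> i\<close> is adjacent to \<open>m i\<close>. A cycle of this relation would be an
  alternating cycle of the graph, and exchanging its matching and non-matching edges would give a
  second perfect matching; so the relation is acyclic. Consequently a co-augmenting path from \<open>i\<close>
  to \<open>j\<close> is either the single edge \<open>i, m i\<close> with \<open>m i = j\<close>, or \<open>i, m i\<close> followed by an
  arbitrary co-augmenting path from some \<open>k\<close> with \<open>i \<rightarrow> k\<close> to \<open>j\<close>: acyclicity keeps the longer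
  walk free of repetitions. For the signed path sums \<open>G i j\<close> this reads
  \<open>G i j = h(i, m i) * ([j = m i] - (\<Sum>k | i \<rightarrow> k. h(m i, k) * G k j))\<close>,
  which, multiplied by \<open>h(m i, i)\<close>, is row \<open>m i\<close> of \<open>H G = 1\<close>.\<close>

text \<open>A closed walk of least length has no repetition: the segment between two occurrences of
  the same vertex would be a shorter closed walk.\<close>

lemma trancl_cycle_distinct:
  assumes "(v, v) \<in> {(x, y). R x y}\<^sup>+"
  shows "\<exists>xs. xs \<noteq> [] \<and> distinct xs \<and> successively R xs \<and> R (last xs) (hd xs)"
proof -
  define closed where "closed xs \<longleftrightarrow> xs \<noteq> [] \<and> successively R xs \<and> R (last xs) (hd xs)" for xs
  \<comment> \<open>The list leaves out the endpoint \<open>w\<close>, so for \<open>w = v\<close>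
    the start of the closed walk is not listed a second time.\<close>
  have walk: "\<exists>xs. xs \<noteq> [] \<and> hd xs = v \<and> successively R xs \<and> R (last xs) w"
    if "(v, w) \<in> {(x, y). R x y}\<^sup>+" for w
    using that
  proof (induction rule: trancl_induct)
    case (base y)
    then show ?case by (intro exI[of _ "[v]"]) auto
  next
    case (step y z)
    then obtain xs where "xs \<noteq> []" "hd xs = v" "successively R xs" "R (last xs) y" "R y z"
      by auto
    then show ?case by (intro exI[of _ "xs @ [y]"]) (auto simp: successively_append_iff)
  qed
  have "\<exists>xs. closed xs" using walk[OF assms] by (auto simp: closed_def)
  then obtain xs where xs: "closed xs" and min: "\<And>ys. closed ys \<Longrightarrow> length xs \<le> length ys"
    using ex_has_least_nat[of closed _ length] by blast
  have "distinct xs"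
  proof (rule ccontr)
    assume "\<not> distinct xs"
    then obtain as y bs cs where eq: "xs = as @ [y] @ bs @ [y] @ cs"
      using not_distinct_decomp by blast
    have "closed (y # bs)"
      using xs unfolding closed_def eq
      by (cases bs) (auto simp: successively_append_iff successively_Cons)
    then show False using min[of "y # bs"] eq by simp
  qed
  then show ?thesis using xs by (auto simp: closed_def)
qed

section \<open>Edge lists of paths\<close>

lemma path_edges_simps [simp]:
  "path_edges [] = []"
  "path_edges [a] = []"
  "path_edges (a # b # p) = {a, b} # path_edges (b # p)"
proof -
  show "path_edges (a # b # p) = {a, b} # path_edges (b # p)"
    by (auto simp: path_edges_def upt_conv_Cons map_Suc_upt[symmetric] simp del: upt_Suc)
qed (simp_all add: path_edges_def)

lemma path_edges_eq_Nil_iff: "path_edges p = [] \<longleftrightarrow> length p \<le> 1"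
  by (auto simp: path_edges_def)

text \<open>Unlike the indexed condition, \<open>successively\<close> unfolds by simplification
  along the list.\<close>

lemma co_augmenting_altdef:
  "co_augmenting M p \<longleftrightarrow> path_edges p \<noteq> [] \<and> hd (path_edges p) \<in> M \<and> last (path_edges p) \<in> M \<and>
     successively (\<lambda>e f. e \<in> M \<longleftrightarrow> f \<notin> M) (path_edges p)"
  unfolding co_augmenting_def successively_conv_nth by auto

section \<open>Matching partners, sides and acyclicity\<close>

locale unique_bipartite_matching =
  fixes E M :: "'v set set"
  assumes bipartite: "bipartite E"
    and perfect: "perfect_matching E M"
    and unique: "perfect_matching E M' \<Longrightarrow> M' = M"
begin

definition mate :: "'v \<Rightarrow> 'v" where
  "mate v = (THE w. {v, w} \<in> M)"

text \<open>A colour class of some bipartition, chosen to contain \<open>v\<close>. Each vertex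
  makes its own choice, so two such sets need be neither equal nor complementary.\<close>

definition side :: "'v \<Rightarrow> 'v set" where
  "side v = (SOME S. v \<in> S \<and> (\<forall>x y. {x, y} \<in> E \<longrightarrow> (x \<in> S \<longleftrightarrow> y \<notin> S)))"

definition step :: "'v \<Rightarrow> 'v \<Rightarrow> bool" where
  "step i k \<longleftrightarrow> k \<noteq> i \<and> {mate i, k} \<in> E"

lemma side: "v \<in> side v" "{x, y} \<in> E \<Longrightarrow> x \<in> side v \<longleftrightarrow> y \<notin> side v"
proof -
  obtain A B where AB: "A \<union> B = UNIV" "A \<inter> B = {}" "\<forall>e \<in> E. \<exists>a \<in> A. \<exists>b \<in> B. e = {a, b}"
    using bipartite by (auto simp: bipartite_def)
  have *: "x \<in> A \<longleftrightarrow> y \<notin> A" if xy: "{x, y} \<in> E" for x y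
  proof -
    obtain a b where "a \<in> A" "b \<in> B" "{x, y} = {a, b}"
      using bspec[OF AB(3) xy] by blast
    then show ?thesis using AB(2) by (auto simp: doubleton_eq_iff)
  qed
  have "\<exists>S. v \<in> S \<and> (\<forall>x y. {x, y} \<in> E \<longrightarrow> (x \<in> S \<longleftrightarrow> y \<notin> S))"
    \<comment> \<open>This set is \<open>A\<close> or its complement, whichever contains
      \<open>v\<close>.\<close>
    using * by (intro exI[of _ "{x. x \<in> A \<longleftrightarrow> v \<in> A}"]) auto
  from someI_ex[OF this, folded side_def]
  show "v \<in> side v" "{x, y} \<in> E \<Longrightarrow> x \<in> side v \<longleftrightarrow> y \<notin> side v" by auto
qed

lemma matching_subset: "M \<subseteq> E"
  using perfect by (simp add: perfect_matching_def)

lemma mem_matching_iff: "{v, w} \<in> M \<longleftrightarrow> w = mate v"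
proof -
  have ex1: "\<exists>!e. e \<in> M \<and> v \<in> e" using perfect by (simp add: perfect_matching_def)
  then obtain e where e: "e \<in> M" "v \<in> e" by blast
  moreover have "\<exists>a b. e = {a, b}"
    using matching_subset bipartite e(1) unfolding bipartite_def by (meson subsetD)
  ultimately obtain u where u: "{v, u} \<in> M" by (auto simp: insert_commute)
  have "w' = u" if "{v, w'} \<in> M" for w'
    using ex1 u that by (metis doubleton_eq_iff insertI1)
  with u show ?thesis
    unfolding mate_def by (metis (no_types, lifting) the_equality)
qed

lemma mate_edge: "{v, mate v} \<in> E" "{mate v, v} \<in> E"
  using mem_matching_iff[of v "mate v"] matching_subset by (auto simp: insert_commute)

lemma mate_mate [simp]: "mate (mate v) = v"
  using mem_matching_iff by (metis insert_commute)

lemma mate_mem_side_iff: "mate x \<in> side v \<longleftrightarrow> x \<notin> side v"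
  using side(2)[OF mate_edge(1)] by blast

text \<open>A step from \<open>x\<close> to \<open>y\<close> passes through \<open>mate x\<close>;
  it traverses two edges and changes side twice.\<close>

lemma step_side: "step x y \<Longrightarrow> x \<in> side v \<longleftrightarrow> y \<in> side v"
  using side(2)[of "mate x" y v] mate_mem_side_iff[of x v] by (auto simp: step_def)

text \<open>The exchange argument: \<open>\<sigma>\<close> rematches the mates of the vertices of
  \<open>K\<close> and keeps the old matching edges elsewhere. A vertex of \<open>side v\<close> is
  \<open>\<sigma> x\<close> for exactly one \<open>x\<close>, a vertex outside it is
  \<open>mate x\<close> for exactly one \<open>x\<close>.\<close>

lemma perfect_matching_permuted:
  assumes \<sigma>: "\<sigma> permutes K" and K: "K \<subseteq> side v" and step: "\<And>x. x \<in> K \<Longrightarrow> step x (\<sigma> x)"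
  shows "perfect_matching E {{mate x, \<sigma> x} | x. x \<in> side v}" (is "perfect_matching E ?M")
  unfolding perfect_matching_def
proof (intro conjI allI)
  \<comment> \<open>Outside \<open>K\<close> the permutation fixes \<open>x\<close>, which leaves
    the matching edge at \<open>x\<close>.\<close>
  have edge: "{mate x, \<sigma> x} \<in> E" for x
    using step[of x] mate_edge(2)[of x] permutes_not_in[OF \<sigma>, of x] by (cases "x \<in> K") (auto simp: step_def)
  then show "?M \<subseteq> E" by auto
  have perm: "\<sigma> permutes side v" using \<sigma> K by (rule permutes_subset)
  then have \<sigma>_side: "\<sigma> x \<in> side v \<longleftrightarrow> x \<in> side v" for x by (rule permutes_in_image)
  fix w
  show "\<exists>!e. e \<in> ?M \<and> w \<in> e"
  proof (cases "w \<in> side v")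
    case True
    then obtain x where x: "w = \<sigma> x" using permutes_surj[OF perm] by blast
    show ?thesis
    proof (rule ex1I[of _ "{mate x, \<sigma> x}"])
      show "{mate x, \<sigma> x} \<in> ?M \<and> w \<in> {mate x, \<sigma> x}" using True x \<sigma>_side by auto
    next
      fix e assume "e \<in> ?M \<and> w \<in> e"
      then obtain y where y: "e = {mate y, \<sigma> y}" "y \<in> side v" "w \<in> e" by auto
      with True have "\<sigma> y = w" using mate_mem_side_iff[of y v] by auto
      then have "y = x" using x permutes_inj[OF perm] by (simp add: inj_eq)
      then show "e = {mate x, \<sigma> x}" using y by simp
    qed
  next
    case False
    show ?thesis
    proof (rule ex1I[of _ "{w, \<sigma> (mate w)}"])
      show "{w, \<sigma> (mate w)} \<in> ?M \<and> w \<in> {w, \<sigma> (mate w)}"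
        using False mate_mem_side_iff[of w v] by (metis (mono_tags, lifting) insertI1 mate_mate mem_Collect_eq)
    next
      fix e assume "e \<in> ?M \<and> w \<in> e"
      then obtain y where y: "e = {mate y, \<sigma> y}" "y \<in> side v" "w \<in> e" by auto
      with False have "w = mate y" using \<sigma>_side[of y] by auto
      then show "e = {w, \<sigma> (mate w)}" using y by simp
    qed
  qed
qed

lemma step_acyclic: "acyclic {(x, y). step x y}"
proof (rule acyclicI, intro allI notI)
  fix v assume "(v, v) \<in> {(x, y). step x y}\<^sup>+"
  from trancl_cycle_distinct[OF this] obtain xs
    where xs: "xs \<noteq> []" "distinct xs" "successively step xs" "step (last xs) (hd xs)"
    by blast
  define x\<^sub>0 where "x\<^sub>0 = hd xs"
  define \<sigma> where "\<sigma> = cycle_of_list xs"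
  \<comment> \<open>Thus \<open>\<sigma>\<close> sends each vertex of the cycle to its cyclic
    successor, the last one to the first.\<close>
  have rot: "map \<sigma> xs = rotate1 xs"
    using cyclic_rotation[OF xs(2), of 1] by (simp add: \<sigma>_def)
  have step: "step x (\<sigma> x)" if x: "x \<in> set xs" for x
  proof -
    from x obtain i where i: "i < length xs" "x = xs ! i" by (auto simp: in_set_conv_nth)
    then have "\<sigma> x = rotate1 xs ! i" by (simp flip: rot)
    also have "\<dots> = xs ! (Suc i mod length xs)" using i by (simp add: nth_rotate1)
    finally have \<sigma>x: "\<sigma> x = xs ! (Suc i mod length xs)" .
    show ?thesis
    proof (cases "Suc i < length xs")
      case True
      then show ?thesis using xs(3) \<sigma>x i by (simp add: successively_conv_nth)
    next
      case False
      then have "Suc i = length xs" using i by simp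
      then show ?thesis using xs(1,4) \<sigma>x i
        by (metis diff_Suc_1 hd_conv_nth last_conv_nth mod_self)
    qed
  qed
  have "xs ! i \<in> side x\<^sub>0" if "i < length xs" for i
    using that
  proof (induction i)
    case 0
    then show ?case using side(1)[of x\<^sub>0] xs(1) by (simp add: x\<^sub>0_def hd_conv_nth)
  next
    case (Suc i)
    then have "step (xs ! i) (xs ! Suc i)" using xs(3) by (simp add: successively_conv_nth)
    then show ?case using Suc step_side by auto
  qed
  then have "set xs \<subseteq> side x\<^sub>0" by (auto simp: in_set_conv_nth)
  moreover have "\<sigma> permutes set xs" unfolding \<sigma>_def by (rule cycle_permutes)
  ultimately have "{{mate x, \<sigma> x} | x. x \<in> side x\<^sub>0} = M"
    using step by (intro unique perfect_matching_permuted)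
  then have "{mate x\<^sub>0, \<sigma> x\<^sub>0} \<in> M" using side(1) by blast
  \<comment> \<open>By uniqueness the exchange has changed nothing, so the partner of
    \<open>mate x\<^sub>0\<close> is still \<open>x\<^sub>0\<close>; but steps are
    irreflexive.\<close>
  then have "\<sigma> x\<^sub>0 = x\<^sub>0" by (simp add: mem_matching_iff)
  moreover have "step x\<^sub>0 (\<sigma> x\<^sub>0)" using step xs(1) by (simp add: x\<^sub>0_def)
  ultimately show False by (simp add: step_def)
qed

section \<open>Co-augmenting walks and their decomposition\<close>

definition co_augmenting_walk :: "'v list \<Rightarrow> bool" where
  "co_augmenting_walk p \<longleftrightarrow> set (path_edges p) \<subseteq> E \<and> co_augmenting M p"

lemma co_augmenting_walk_edge: "co_augmenting_walk [i, mate i]"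
  by (auto simp: co_augmenting_walk_def co_augmenting_altdef mem_matching_iff mate_edge)

lemma co_augmenting_walk_length: "co_augmenting_walk p \<Longrightarrow> 2 \<le> length p"
  by (auto simp: co_augmenting_walk_def co_augmenting_altdef path_edges_eq_Nil_iff)

lemma co_augmenting_walk_extend_iff:
  "co_augmenting_walk (i # mate i # c # d # q) \<longleftrightarrow> step i c \<and> co_augmenting_walk (c # d # q)"
  by (auto simp: co_augmenting_walk_def co_augmenting_altdef mem_matching_iff mate_edge step_def)

lemma co_augmenting_walk_cases [consumes 1, case_names edge extend]:
  assumes "co_augmenting_walk p"
  obtains i where "p = [i, mate i]"
    | i q where "p = i # mate i # q" "step i (hd q)" "co_augmenting_walk q"
proof -
  obtain i b q where p: "p = i # b # q"
    using co_augmenting_walk_length[OF assms] by (metis Suc_le_length_iff numeral_2_eq_2)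
  with assms have b: "b = mate i"
    by (auto simp: co_augmenting_walk_def co_augmenting_altdef mem_matching_iff)
  show thesis
  proof (cases q)
    case Nil
    then show thesis using that(1) p b by simp
  next
    case (Cons c q')
    \<comment> \<open>A walk of three vertices would end with \<open>{mate i, c}\<close>, which
      alternation puts outside \<open>M\<close> and the condition on the last edge puts
      inside.\<close>
    have "q' \<noteq> []"
      using assms unfolding p b Cons
      by (auto simp: co_augmenting_walk_def co_augmenting_altdef mem_matching_iff)
    then obtain d q'' where "q' = d # q''" by (cases q') auto
    then show thesis
      using that(2)[of i q] assms Cons p b co_augmenting_walk_extend_iff by auto
  qed
qed

lemma co_augmenting_walk_ConsI:
  assumes "step i (hd q)" "co_augmenting_walk q"
  shows "co_augmenting_walk (i # mate i # q)"
proof -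
  obtain c d q' where "q = c # d # q'"
    using co_augmenting_walk_length[OF assms(2)] by (metis Suc_le_length_iff numeral_2_eq_2)
  then show ?thesis using assms by (simp add: co_augmenting_walk_extend_iff)
qed

text \<open>The walk alternates between vertices reached from its head by steps and the mates of
  those vertices; the side of \<open>v\<close> tells which of the two kinds it is.\<close>

lemma co_augmenting_walk_reach:
  assumes "co_augmenting_walk p" "v \<in> set p"
  shows "v \<in> side (hd p) \<and> (hd p, v) \<in> {(x, y). step x y}\<^sup>* \<or>
         v \<notin> side (hd p) \<and> (hd p, mate v) \<in> {(x, y). step x y}\<^sup>*"
  using assms
proof (induction "length p" arbitrary: p rule: less_induct)
  case less
  from less.prems(1) show ?case
  proof (cases rule: co_augmenting_walk_cases)
    case (edge i)
    then show ?thesis using less.prems side(1)[of i] mate_mem_side_iff[of i i] by auto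
  next
    case (extend i q)
    have i: "i \<in> side i" "mate i \<notin> side i" using side(1)[of i] mate_mem_side_iff[of i i] by auto
    show ?thesis
    proof (cases "v \<in> set q")
      case True
      have "hd q \<in> side i" using i step_side[OF extend(2)] by blast
      \<comment> \<open>The two sides are chosen independently, but they agree on everything
        reachable from \<open>hd q\<close>, since steps preserve both.\<close>
      have same: "x \<in> side (hd q) \<longleftrightarrow> x \<in> side i" if "(hd q, x) \<in> {(x, y). step x y}\<^sup>*" for x
        using that
      proof (induction rule: rtrancl_induct)
        case base
        then show ?case using side(1) \<open>hd q \<in> side i\<close> by blast
      next
        case (step y z)
        then show ?case using step_side by blast
      qed
      have "v \<in> side (hd q) \<and> (hd q, v) \<in> {(x, y). step x y}\<^sup>* \<or>
            v \<notin> side (hd q) \<and> (hd q, mate v) \<in> {(x, y). step x y}\<^sup>*"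
        using less.hyps[of q] extend True by simp
      then show ?thesis
        using same[of v] same[of "mate v"] mate_mem_side_iff[of v] extend(1,2)
        by (auto intro: converse_rtrancl_into_rtrancl)
    next
      case False
      then show ?thesis using less.prems(2) extend(1) i by auto
    qed
  qed
qed

text \<open>Walks are defined without distinctness, so that they can be extended freely. If
  \<open>i\<close> or \<open>mate i\<close> occurred again in the tail \<open>q\<close>, then
  \<open>i\<close> would be reachable from \<open>hd q\<close>, and \<open>step i (hd q)\<close>
  would close a cycle.\<close>

lemma co_augmenting_walk_distinct: "co_augmenting_walk p \<Longrightarrow> distinct p"
proof (induction "length p" arbitrary: p rule: less_induct)
  case less
  from less.prems show ?case
  proof (cases rule: co_augmenting_walk_cases)
    case (edge i)
    then show ?thesis using side(1)[of i] mate_mem_side_iff[of i i] by auto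
  next
    case (extend i q)
    have acyc: "(hd q, i) \<notin> {(x, y). step x y}\<^sup>*"
      using step_acyclic extend(2) unfolding acyclic_def
      by (metis (mono_tags, lifting) case_prod_conv mem_Collect_eq rtrancl_into_trancl2)
    have i: "i \<in> side (hd q)" using side(1) step_side[OF extend(2)] by blast
    then have "mate i \<notin> side (hd q)" by (simp add: mate_mem_side_iff)
    then have "i \<notin> set q" "mate i \<notin> set q"
      using acyc i co_augmenting_walk_reach[OF extend(3)] by fastforce+
    moreover have "i \<noteq> mate i" using i \<open>mate i \<notin> side (hd q)\<close> by auto
    moreover have "distinct q" using less.hyps extend by simp
    ultimately show ?thesis using extend(1) by simp
  qed
qed

definition walks :: "'v \<Rightarrow> 'v \<Rightarrow> 'v list set" where
  "walks i j = {p. co_augmenting_walk p \<and> hd p = i \<and> last p = j}"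

lemma walks_rec:
  "walks i j = (if j = mate i then {[i, mate i]} else {}) \<union>
     (\<Union>k \<in> {k. step i k}. (\<lambda>q. i # mate i # q) ` walks k j)"
  (is "_ = ?R")
proof (intro equalityI subsetI)
  fix p assume "p \<in> walks i j"
  then have p: "co_augmenting_walk p" "hd p = i" "last p = j" by (auto simp: walks_def)
  from p(1) show "p \<in> ?R"
  proof (cases rule: co_augmenting_walk_cases)
    case (edge i')
    then show ?thesis using p by auto
  next
    case (extend i' q)
    then show ?thesis using p co_augmenting_walk_length[OF extend(3)]
      by (auto simp: walks_def split: if_splits)
  qed
next
  fix p assume "p \<in> ?R"
  then show "p \<in> walks i j"
    using co_augmenting_walk_edge[of i] co_augmenting_walk_ConsI[of i] co_augmenting_walk_length
    by (fastforce simp: walks_def split: if_splits)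
qed

lemma walks_self: "walks i i = {}"
proof -
  have False if "co_augmenting_walk p" "hd p = i" "last p = i" for p
    using co_augmenting_walk_distinct[OF that(1)] co_augmenting_walk_length[OF that(1)] that(2,3)
    by (cases p) (auto split: if_splits)
  then show ?thesis by (auto simp: walks_def)
qed

end

text \<open>Distinctness bounds the length by the number of vertices. The lemma stands outside the
  locale because the vertex type there is not assumed finite.\<close>

lemma finite_walks:
  fixes E M :: "'v::finite set set"
  assumes "unique_bipartite_matching E M"
  shows "finite (unique_bipartite_matching.walks E M i j)"
proof -
  interpret unique_bipartite_matching E M by fact
  have "walks i j \<subseteq> {p. set p \<subseteq> UNIV \<and> length p \<le> CARD('v)}"
  proof
    fix p assume "p \<in> walks i j"
    then have "length p = card (set p)"
      by (simp add: walks_def co_augmenting_walk_distinct distinct_card)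
    also have "\<dots> \<le> CARD('v)" by (rule card_mono) auto
    finally show "p \<in> {p. set p \<subseteq> UNIV \<and> length p \<le> CARD('v)}" by simp
  qed
  then show ?thesis by (rule finite_subset) (rule finite_lists_length_le, simp)
qed

lemma co_augmenting_paths_eq_walks:
  fixes X :: "'v::finite mixed_graph"
  assumes "unique_bipartite_matching (underlying_edges X) M"
  shows "co_augmenting_paths X M i j = unique_bipartite_matching.walks (underlying_edges X) M i j"
proof -
  interpret unique_bipartite_matching "underlying_edges X" M by fact
  show ?thesis
    using co_augmenting_walk_distinct co_augmenting_walk_length
    by (fastforce simp: co_augmenting_paths_def walks_def mixed_path_def co_augmenting_walk_def)
qed

section \<open>Matrix entries and signed path sums\<close>

lemma hermitian_adjacency_nonedge:
  "{u, v} \<notin> underlying_edges X \<Longrightarrow> hermitian_adjacency \<alpha> X $ u $ v = 0"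
  by (auto simp: hermitian_adjacency_def underlying_edges_def insert_commute)

lemma hermitian_adjacency_edge:
  assumes "wf_mixed_graph X" "norm \<alpha> = 1" "{u, v} \<in> underlying_edges X"
  shows "hermitian_adjacency \<alpha> X $ u $ v * hermitian_adjacency \<alpha> X $ v $ u = 1"
proof -
  have "\<alpha> * cnj \<alpha> = 1" using assms(2) by (simp add: complex_norm_square[symmetric])
  then show ?thesis
    using assms(1,3)
    by (auto simp: hermitian_adjacency_def underlying_edges_def wf_mixed_graph_def insert_commute
        doubleton_eq_iff mult.commute)
qed

lemma path_weight_Cons_Cons:
  "path_weight \<alpha> X (a # b # p) = hermitian_adjacency \<alpha> X $ a $ b * path_weight \<alpha> X (b # p)"
  by (simp add: path_weight_def prod.lessThan_Suc_shift del: prod.lessThan_Suc)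

text \<open>On a co-augmenting path, which has an odd number of edges, the exponent counts the edges
  outside the matching.\<close>

definition signed_weight :: "complex \<Rightarrow> 'v::finite mixed_graph \<Rightarrow> 'v list \<Rightarrow> complex" where
  "signed_weight \<alpha> X p = (-1) ^ ((length (path_edges p) - 1) div 2) * path_weight \<alpha> X p"

lemma signed_weight_edge: "signed_weight \<alpha> X [a, b] = hermitian_adjacency \<alpha> X $ a $ b"
  by (simp add: signed_weight_def path_weight_def)

text \<open>Prepending two edges raises the exponent by one. This fails for a one-vertex
  \<open>q\<close>: truncated subtraction makes the exponent 0 both before and after.\<close>

lemma signed_weight_extend:
  assumes "2 \<le> length q"
  shows "signed_weight \<alpha> X (a # b # q) =
    - hermitian_adjacency \<alpha> X $ a $ b * hermitian_adjacency \<alpha> X $ b $ hd q * signed_weight \<alpha> X q"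
proof -
  obtain c d q' where "q = c # d # q'"
    using assms by (metis Suc_le_length_iff numeral_2_eq_2)
  then show ?thesis by (simp add: signed_weight_def path_weight_Cons_Cons)
qed

lemma signed_walk_sum_rec:
  fixes X :: "'v::finite mixed_graph" and \<alpha> :: complex
  assumes "unique_bipartite_matching (underlying_edges X) M"
  defines "mate \<equiv> unique_bipartite_matching.mate M"
    and "step \<equiv> unique_bipartite_matching.step (underlying_edges X) M"
    and "G \<equiv> \<lambda>i j. \<Sum>p \<in> unique_bipartite_matching.walks (underlying_edges X) M i j. signed_weight \<alpha> X p"
    and "h \<equiv> \<lambda>i j. hermitian_adjacency \<alpha> X $ i $ j"
  shows "G i j = h i (mate i) * ((if j = mate i then 1 else 0) - (\<Sum>k | step i k. h (mate i) k * G k j))"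
proof -
  interpret U: unique_bipartite_matching "underlying_edges X" M by fact
  note [simp] = mate_def step_def
  let ?A = "if j = mate i then {[i, mate i]} else {}"
  let ?B = "\<lambda>k. (\<lambda>q. i # mate i # q) ` U.walks k j"
  let ?w = "signed_weight \<alpha> X"
  have fin: "finite (U.walks k j)" for k using assms(1) by (rule finite_walks)
  have len: "2 \<le> length q" if "q \<in> U.walks k j" for q k
    using that U.co_augmenting_walk_length by (auto simp: U.walks_def)
  have "G i j = sum ?w (?A \<union> (\<Union>k \<in> {k. step i k}. ?B k))"
    unfolding G_def by (subst U.walks_rec) simp
  also have "\<dots> = sum ?w ?A + sum ?w (\<Union>k \<in> {k. step i k}. ?B k)"
    \<comment> \<open>The single edge has two vertices, every extended walk at least four.\<close>
    using fin len by (intro sum.union_disjoint) (fastforce split: if_splits)+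
  also have "sum ?w (\<Union>k \<in> {k. step i k}. ?B k) = (\<Sum>k | step i k. sum ?w (?B k))"
    \<comment> \<open>The third vertex of an extended walk determines \<open>k\<close>.\<close>
    using fin by (intro sum.UNION_disjoint) (auto simp: U.walks_def)
  also have "\<dots> = (\<Sum>k | step i k. - h i (mate i) * (h (mate i) k * G k j))"
  proof (rule sum.cong[OF refl])
    fix k
    have "sum ?w (?B k) = (\<Sum>q \<in> U.walks k j. ?w (i # mate i # q))"
      by (subst sum.reindex) (auto simp: inj_on_def)
    also have "\<dots> = (\<Sum>q \<in> U.walks k j. - h i (mate i) * (h (mate i) k * ?w q))"
      using len by (intro sum.cong refl) (auto simp: signed_weight_extend h_def U.walks_def)
    finally show "sum ?w (?B k) = - h i (mate i) * (h (mate i) k * G k j)"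
      by (simp add: sum_distrib_left sum_negf G_def)
  qed
  also have "sum ?w ?A = h i (mate i) * (if j = mate i then 1 else 0)"
    by (simp add: signed_weight_edge h_def)
  finally show ?thesis by (simp add: sum_distrib_left sum_negf right_diff_distrib)
qed

theorem theorem8:
  fixes X :: "'v::finite mixed_graph" and M :: "'v set set" and \<alpha> :: complex
  assumes "wf_mixed_graph X"
    and "bipartite (underlying_edges X)"
    and "perfect_matching (underlying_edges X) M"
    and "\<And>M'. perfect_matching (underlying_edges X) M' \<Longrightarrow> M' = M"
    and "norm \<alpha> = 1"
  shows "invertible (hermitian_adjacency \<alpha> X) \<and>
    (\<forall>i j. matrix_inv (hermitian_adjacency \<alpha> X) $ i $ j =
      (if i \<noteq> j
       then \<Sum>p \<in> co_augmenting_paths X M i j.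
              (-1) ^ ((length (path_edges p) - 1) div 2) * path_weight \<alpha> X p
       else 0))"
proof -
  have U: "unique_bipartite_matching (underlying_edges X) M"
    using assms(2-4) by unfold_locales
  interpret U: unique_bipartite_matching "underlying_edges X" M by fact
  define H where "H = hermitian_adjacency \<alpha> X"
  define G where "G = (\<chi> i j. \<Sum>p \<in> U.walks i j. signed_weight \<alpha> X p)"
  have row: "(\<Sum>k \<in> UNIV. H $ U.mate i $ k * G $ k $ j) = (if j = U.mate i then 1 else 0)" for i j
  proof -
    let ?S = "\<Sum>k | U.step i k. H $ U.mate i $ k * G $ k $ j"
    \<comment> \<open>The neighbours of \<open>mate i\<close> are \<open>i\<close> itself and the
      targets of steps from \<open>i\<close>.\<close>
    have zero: "H $ U.mate i $ k = 0" if "k \<notin> insert i {k. U.step i k}" for k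
      using that unfolding H_def by (intro hermitian_adjacency_nonedge) (auto simp: U.step_def)
    have "(\<Sum>k \<in> UNIV. H $ U.mate i $ k * G $ k $ j) =
        (\<Sum>k \<in> insert i {k. U.step i k}. H $ U.mate i $ k * G $ k $ j)"
      using zero by (intro sum.mono_neutral_right) auto
    also have "\<dots> = H $ U.mate i $ i * G $ i $ j + ?S"
      by (subst sum.insert) (auto simp: U.step_def)
    also have "G $ i $ j = H $ i $ U.mate i * ((if j = U.mate i then 1 else 0) - ?S)"
      using signed_walk_sum_rec[OF U, of \<alpha> i j] by (simp add: G_def H_def)
    also have "H $ U.mate i $ i * \<dots> = (if j = U.mate i then 1 else 0) - ?S"
      using hermitian_adjacency_edge[OF assms(1,5) U.mate_edge(2)[of i]]
      by (simp add: H_def mult.assoc[symmetric])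
    finally show ?thesis by simp
  qed
  have HG: "H ** G = mat 1"
  proof -
    \<comment> \<open>Since \<open>mate\<close> is an involution, every row is the row of some
      mate.\<close>
    have "(\<Sum>k \<in> UNIV. H $ i $ k * G $ k $ j) = (if i = j then 1 else 0)" for i j
      using row[of "U.mate i" j] by auto
    then show ?thesis by (simp add: vec_eq_iff matrix_matrix_mult_def mat_def)
  qed
  then have GH: "G ** H = mat 1" by (simp add: matrix_left_right_inverse)
  have inv: "invertible H" unfolding invertible_def using HG GH by blast
  \<comment> \<open>\<open>matrix_inv\<close> is a choice among two-sided inverses, and
    \<open>G\<close> witnesses that one exists.\<close>
  have "matrix_inv H ** H = mat 1"
    using HG GH unfolding matrix_inv_def by (rule someI2[of _ G, OF conjI]) auto
  then have "matrix_inv H = G"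
    using HG by (metis matrix_mul_assoc matrix_mul_lid matrix_mul_rid)
  then show ?thesis
    \<comment> \<open>On the diagonal \<open>G\<close> is an empty sum, which matches the case
      \<open>i = j\<close>.\<close>
    using inv U.walks_self
    by (auto simp: H_def G_def signed_weight_def co_augmenting_paths_eq_walks[OF U])
qed

end
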